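(* Let $v>k>i\ge 0$ be integers with $v\ge 2k$ and $(v,k,i)\neq(2k,k,0)$, let $X=J(v,k,i)$ and $\Delta=v-2k+2i$. Then the odd girth of $X$ is $$og(X)=2\left\lceil\frac{k-i}{\Delta}\right\rceil+1.$$
   Context: For integers $v>k>i\ge 0$, the generalized Johnson graph $J(v,k,i)$ is the simple undirected graph whose vertices are the $k$-element subsets of a fixed $v$-element set, two vertices $A,B$ being adjacent iff $|A\cap B|=i$. The odd girth is the length of a shortest odd cycle. *)

theory Defs
  imports
    Complex_Main
    "HOL-Library.Extended_Nat"
    "Graph_Theory.Graph_Theory"
begin

text \<open>
  Simple undirected graphs are represented as in the entry \<open>Graph_Theory\<close>: an edge
  joining A and B is the pair of opposite arcs (A, B) and (B, A), and the resulting
  digraph is symmetric and loop-free (locale \<^locale>\<open>pair_graph\<close>).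
\<close>

definition gen_johnson :: "'a set \<Rightarrow> nat \<Rightarrow> nat \<Rightarrow> 'a set pair_pre_digraph" where
  "gen_johnson V k i =
     \<lparr> pverts = {A. A \<subseteq> V \<and> card A = k},
       parcs = {(A, B). A \<subseteq> V \<and> card A = k \<and> B \<subseteq> V \<and> card B = k \<and> card (A \<inter> B) = i} \<rparr>"

text \<open>For \<open>i = k\<close> every vertex would carry a loop.\<close>

lemma pair_graph_gen_johnson:
  assumes "finite V" and "i < k"
  shows "pair_graph (gen_johnson V k i)"
proof -
  let ?J = "gen_johnson V k i"
  have fin: "finite (pverts ?J)"
    using assms(1) by (simp add: gen_johnson_def)
  have sub: "parcs ?J \<subseteq> pverts ?J \<times> pverts ?J"
    by (auto simp: gen_johnson_def)
  have fin': "finite (parcs ?J)"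
    using finite_subset[OF sub] fin by simp
  have sym: "sym (parcs ?J)"
    by (rule symI) (simp add: gen_johnson_def Int_commute)
  have irrefl: "fst e \<noteq> snd e" if "e \<in> parcs ?J" for e
    using that assms(2) by (cases e) (auto simp: gen_johnson_def)
  show ?thesis
  proof
    show "fst e \<in> pverts ?J" "snd e \<in> pverts ?J" if "e \<in> parcs ?J" for e
      using that sub by auto
    show "symmetric (with_proj ?J)"
      using sym by (simp add: symmetric_def)
  qed (use fin fin' irrefl in blast)+
qed

text \<open>
  The constant \<^const>\<open>pre_digraph.cycle\<close> also accepts the closed walk A, B, A along the
  two arcs of one edge. That walk has even length, and in a loop-free symmetric digraph the
  cycles of odd length are exactly the (rooted, oriented) odd cycles of the undirected graph.
  The infimum over \<^typ>\<open>enat\<close> is the minimum if an odd cycle exists, and \<open>\<infinity>\<close> otherwise.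
\<close>

definition odd_girth :: "'a pair_pre_digraph \<Rightarrow> enat" where
  "odd_girth G = Inf {enat (length p) |p. pre_digraph.cycle (with_proj G) p \<and> odd (length p)}"

end

theory Submission
  imports Defs
begin

text \<open>
  Let A, B, C be vertices with A adjacent to B and B adjacent to C. Both \<open>A - B\<close> and \<open>C - B\<close>
  have size \<open>k - i\<close> and lie in the complement of B, so they share at least \<open>k - \<Delta>\<close> points, and
  \<open>A - C\<close> has at most \<open>\<Delta>\<close> points. Conversely, if \<open>A - C\<close> has at most \<open>min \<Delta> (k - i)\<close> points,
  then A and C have a common neighbour. A closed walk of length \<open>2 * m + 1\<close> is a walk of length
  \<open>2 * m\<close> between adjacent vertices A and C, for which \<open>A - C\<close> has \<open>k - i\<close> points; hence one exists
  iff \<open>k - i \<le> m * \<Delta>\<close>. Finally, a shortest odd closed walk is a cycle.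
\<close>

section \<open>Odd girth and closed walks\<close>

text \<open>Strong induction on the length: a repeated vertex cuts the walk into two shorter closed
  walks, one of which is odd.\<close>

lemma (in wf_digraph) odd_closed_walk_imp_odd_cycle:
  assumes "awalk u p u" and "odd (length p)"
  obtains c where "cycle c" and "odd (length c)" and "length c \<le> length p"
  using assms
proof (induction "length p" arbitrary: p u thesis rule: less_induct)
  case less
  show ?case
  proof (cases "distinct (tl (awalk_verts u p))")
    case True
    then have "cycle p"
      using less.prems unfolding cycle_def by auto
    then show ?thesis using less.prems by blast
  next
    case False
    with less.prems obtain e es where p: "p = e # es" by (cases p) auto
    have es: "awalk (head G e) es u" "\<not> distinct (awalk_verts (head G e) es)"
      using False less.prems(2) by (auto simp: p awalk_Cons_iff)
    obtain q r s w where qrs: "es = q @ r @ s" "0 < length r"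
      and w: "awalk (head G e) q w" "awalk w r w" "awalk w s u"
      using awalk_not_distinct_decomp[OF es] by blast
    have rest: "awalk u (e # q @ s) u"
      using less.prems(2) awalk_appendI[OF w(1,3)] by (simp add: p awalk_Cons_iff)
    \<comment> \<open>The closed walks \<open>r\<close> at \<open>w\<close> and
      \<open>e # q @ s\<close> at \<open>u\<close> have odd total length. Both are shorter than
      \<open>p\<close>: the first misses \<open>e\<close>, the second misses the nonempty
      \<open>r\<close>.\<close>
    show ?thesis
    proof (cases "odd (length r)")
      case True
      obtain c where "cycle c" "odd (length c)" "length c \<le> length r"
        by (rule less.hyps[OF _ _ w(2) True]) (auto simp: p qrs)
      then show ?thesis using less.prems(1)[of c] by (simp add: p qrs)
    next
      case False
      have odd: "odd (length (e # q @ s))" using False less.prems(3) by (simp add: p qrs)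
      obtain c where "cycle c" "odd (length c)" "length c \<le> length (e # q @ s)"
        by (rule less.hyps[OF _ _ rest odd]) (use qrs in \<open>auto simp: p\<close>)
      then show ?thesis using less.prems(1)[of c] by (simp add: p qrs)
    qed
  qed
qed

text \<open>The vertex hypothesis is for \<open>n = 0\<close>: the power is then the identity on the
  whole type, whereas an empty \<open>awalk\<close> starts at a vertex.\<close>

lemma (in pair_wf_digraph) relpow_parcs_iff_awalk:
  assumes "u \<in> pverts G"
  shows "(u, v) \<in> parcs G ^^ n \<longleftrightarrow> (\<exists>p. awalk u p v \<and> length p = n)"
  using assms
proof (induction n arbitrary: u)
  case 0
  then show ?case by (auto simp: awalk_Nil_iff)
next
  case (Suc n)
  have "(u, v) \<in> parcs G ^^ Suc n
      \<longleftrightarrow> (\<exists>w. (u, w) \<in> parcs G \<and> (w, v) \<in> parcs G ^^ n)"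
    by (meson relpow_Suc_D2 relpow_Suc_I2)
  also have "\<dots> \<longleftrightarrow> (\<exists>w. (u, w) \<in> parcs G \<and> (\<exists>p. awalk w p v \<and> length p = n))"
    using Suc.IH in_arcsD2 by blast
  also have "\<dots> \<longleftrightarrow> (\<exists>p. awalk u p v \<and> length p = Suc n)"
  proof safe
    fix w p assume "(u, w) \<in> parcs G" "awalk w p v"
    then show "\<exists>p'. awalk u p' v \<and> length p' = Suc (length p)"
      by (intro exI[of _ "(u, w) # p"]) (simp add: awalk_Cons_iff)
  next
    fix p assume "awalk u p v" "length p = Suc n"
    then show "\<exists>w. (u, w) \<in> parcs G \<and> (\<exists>p. awalk w p v \<and> length p = n)"
      by (cases p) (simp, fastforce simp: awalk_Cons_iff)
  qed
  finally show ?case .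
qed

text \<open>A cycle is a closed walk, so \<open>n\<close> is a lower bound; the odd cycle extracted
  from the closed walk at \<open>u\<close> has length at most \<open>n\<close> and thus attains
  it.\<close>

lemma odd_girth_eqI:
  assumes "pair_wf_digraph G" and "(u, u) \<in> parcs G ^^ n" and "odd n"
    and least: "\<And>w l. (w, w) \<in> parcs G ^^ l \<Longrightarrow> odd l \<Longrightarrow> n \<le> l"
  shows "odd_girth G = enat n"
proof -
  interpret pair_wf_digraph G by fact
  have le: "n \<le> length p" if p: "cycle p" "odd (length p)" for p
  proof -
    from p(1) obtain w where "awalk w p w" by (auto simp: cycle_def)
    then show ?thesis
      using relpow_parcs_iff_awalk[of w w "length p"] least p(2) awalk_hd_in_verts by auto
  qed
  \<comment> \<open>An odd \<open>n\<close> is positive, so a first arc exists and \<open>u\<close>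
    is a vertex.\<close>
  from \<open>odd n\<close> obtain n' where "n = Suc n'" using odd_pos gr0_conv_Suc by blast
  then have "u \<in> pverts G"
    using assms(2) in_arcsD1 relpow_Suc_D2 by metis
  then obtain p where "awalk u p u" "length p = n"
    using relpow_parcs_iff_awalk assms(2) by blast
  then obtain c where c: "cycle c" "odd (length c)" "length c \<le> n"
    using odd_closed_walk_imp_odd_cycle \<open>odd n\<close> by blast
  then have "length c = n" using le by force
  with c have "enat n \<in> {enat (length p) |p. cycle p \<and> odd (length p)}" by blast
  then show ?thesis
    unfolding odd_girth_def using le by (intro antisym Inf_lower Inf_greatest) auto
qed

section \<open>Walks in generalized Johnson graphs\<close>

lemma gen_johnson_arc_iff:
  "(A, B) \<in> parcs (gen_johnson V k i)
    \<longleftrightarrow> A \<subseteq> V \<and> card A = k \<and> B \<subseteq> V \<and> card B = k \<and> card (A \<inter> B) = i"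
  by (simp add: gen_johnson_def)

section \<open>Upper bounds on differences along even walks\<close>

lemma card_Diff_le_card_Diff_add:
  assumes "finite A" and "finite B"
  shows "card (A - C) \<le> card (A - B) + card (B - C)"
proof -
  have "card (A - C) \<le> card ((A - B) \<union> (B - C))"
    using assms by (intro card_mono) auto
  then show ?thesis using card_Un_le[of "A - B" "B - C"] by linarith
qed

text \<open>\<open>C - B\<close> and \<open>A - C\<close> are disjoint, and both lie in
  \<open>(V - B) \<union> (A \<inter> B)\<close>, a set of size \<open>card V - k + i\<close>;
  moreover \<open>C - B\<close> has \<open>k - i\<close> points.\<close>

lemma gen_johnson_two_steps_card_Diff_le:
  assumes "finite V"
    and AB: "(A, B) \<in> parcs (gen_johnson V k i)" and BC: "(B, C) \<in> parcs (gen_johnson V k i)"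
  shows "2 * k + card (A - C) \<le> card V + 2 * i"
proof -
  note arcs = AB[unfolded gen_johnson_arc_iff] BC[unfolded gen_johnson_arc_iff]
  have fin: "finite A" "finite B" "finite C"
    using arcs \<open>finite V\<close> by (auto intro: finite_subset)
  have "card (C - B) + card (A - C) = card ((C - B) \<union> (A - C))"
    using fin by (intro card_Un_disjoint[symmetric]) auto
  also have "\<dots> \<le> card ((V - B) \<union> (A \<inter> B))"
    using arcs fin \<open>finite V\<close> by (intro card_mono) auto
  also have "\<dots> \<le> card (V - B) + card (A \<inter> B)"
    by (rule card_Un_le)
  finally have "card (C - B) + card (A - C) \<le> card (V - B) + i"
    using arcs by simp
  moreover have "card (V - B) + k = card V"
    using arcs fin \<open>finite V\<close> card_mono[of V B] by (simp add: card_Diff_subset)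
  moreover have "card (C - B) + i = k"
    using arcs fin card_mono[of C "C \<inter> B"] by (simp add: card_Diff_subset_Int Int_commute)
  ultimately show ?thesis by linarith
qed

text \<open>By the triangle inequality each pair of arcs adds at most \<Delta>. The subtraction is
  not truncated once \<open>m > 0\<close>, since two consecutive arcs force
  \<open>2 * k \<le> card V + 2 * i\<close>.\<close>

lemma gen_johnson_even_walk_card_Diff_le:
  assumes "finite V" and "A \<subseteq> V" and "(A, C) \<in> parcs (gen_johnson V k i) ^^ (2 * m)"
  shows "card (A - C) \<le> m * (card V + 2 * i - 2 * k)"
  using assms(3)
proof (induction m arbitrary: C)
  case 0
  then show ?case by simp
next
  case (Suc m)
  then obtain C' B where walk: "(A, C') \<in> parcs (gen_johnson V k i) ^^ (2 * m)"
    and B: "(C', B) \<in> parcs (gen_johnson V k i)" "(B, C) \<in> parcs (gen_johnson V k i)"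
    by auto
  have fin: "finite C'"
    using B(1) assms(1) by (auto simp: gen_johnson_arc_iff intro: finite_subset)
  have "card (C' - C) \<le> card V + 2 * i - 2 * k"
    using gen_johnson_two_steps_card_Diff_le[OF assms(1) B] by linarith
  then show ?case
    using Suc.IH[OF walk] card_Diff_le_card_Diff_add[of A C' C] fin finite_subset[OF \<open>A \<subseteq> V\<close> assms(1)]
    by simp
qed

section \<open>Construction of even walks\<close>

text \<open>\<open>B\<close> is assembled from the four regions cut out by \<open>A\<close> and
  \<open>C\<close>: \<open>x\<close> points of \<open>A \<inter> C\<close>, \<open>i - x\<close>
  from each of \<open>A - C\<close> and \<open>C - A\<close>, and the remaining
  \<open>k + x - 2 * i\<close> from outside both.\<close>

lemma gen_johnson_common_neighbour:
  assumes "finite V" and "2 * k \<le> card V"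
    and A: "A \<subseteq> V" "card A = k" and C: "C \<subseteq> V" "card C = k"
    and "2 * k + card (A - C) \<le> card V + 2 * i" and "card (A - C) + i \<le> k"
  obtains B where "(A, B) \<in> parcs (gen_johnson V k i)" "(B, C) \<in> parcs (gen_johnson V k i)"
proof -
  define d where "d = card (A - C)"
  have fin: "finite A" "finite C" using A C \<open>finite V\<close> by (auto intro: finite_subset)
  have cAC: "card (A \<inter> C) + d = k"
    using fin A card_mono[of A "A \<inter> C"] by (simp add: d_def card_Diff_subset_Int)
  have cCA: "card (C - A) = d"
    using card_le_sym_Diff[of A C] card_le_sym_Diff[of C A] fin A C by (simp add: d_def)
  have "card (A \<union> C) = k + d"
    using card_Un_disjoint[of A "C - A"] fin A cCA by simp
  then have cO: "card (V - (A \<union> C)) = card V - (k + d)"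
    using A C fin by (simp add: card_Diff_subset)
  \<comment> \<open>The least \<open>x\<close> with \<open>i - x \<le> d\<close> and
    \<open>2 * i \<le> k + x\<close>, which keeps the outside piece as small as possible.\<close>
  define x where "x = max (i - d) (2 * i - k)"
  \<comment> \<open>The last bound follows from \<open>2 * k \<le> card V\<close> unless truncation
    sets \<open>x = 0\<close>; then it is the hypothesis on
    \<open>2 * k + card (A - C)\<close>.\<close>
  have bounds: "x \<le> i" "x + d \<le> k" "i \<le> x + d" "2 * i \<le> k + x" "(k + x - 2 * i) + (k + d) \<le> card V"
    using assms(2,7,8) unfolding x_def d_def[symmetric] by auto
  obtain P where P: "P \<subseteq> A \<inter> C" "card P = x" "finite P"
    using obtain_subset_with_card_n[of x "A \<inter> C"] bounds cAC by auto
  obtain Q where Q: "Q \<subseteq> A - C" "card Q = i - x" "finite Q"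
    using obtain_subset_with_card_n[of "i - x" "A - C"] bounds(3) d_def by force
  obtain R where R: "R \<subseteq> C - A" "card R = i - x" "finite R"
    using obtain_subset_with_card_n[of "i - x" "C - A"] bounds(3) cCA by force
  obtain S where S: "S \<subseteq> V - (A \<union> C)" "card S = k + x - 2 * i" "finite S"
    using obtain_subset_with_card_n[of "k + x - 2 * i" "V - (A \<union> C)"] bounds(5) cO
    by (metis add_le_imp_le_diff)
  define B where "B = (P \<union> Q) \<union> (R \<union> S)"
  have "card (P \<union> Q) = i" "card (P \<union> R) = i"
    using P Q R bounds by (subst card_Un_disjoint; auto)+
  moreover have "card (R \<union> S) = k - i"
    using R S bounds by (subst card_Un_disjoint) auto
  moreover have "card B = card (P \<union> Q) + card (R \<union> S)"
    unfolding B_def using P Q R S by (intro card_Un_disjoint) auto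
  moreover have "A \<inter> B = P \<union> Q" "B \<inter> C = P \<union> R"
    unfolding B_def using P Q R S by auto
  moreover have "B \<subseteq> V"
    unfolding B_def using P Q R S A C by auto
  ultimately show thesis
    using that[of B] A C assms(8) by (auto simp: gen_johnson_arc_iff)
qed

text \<open>\<open>C\<close> is moved towards \<open>A\<close> by exchanging at most \<Delta>
  points, and a common neighbour bridges each exchange. The bound
  \<open>card (A - C) + i \<le> k\<close> persists because the difference only shrinks.\<close>

lemma gen_johnson_even_walk_exists:
  assumes "finite V" and "2 * k \<le> card V"
    and A: "A \<subseteq> V" "card A = k" and "C \<subseteq> V" "card C = k"
    and "card (A - C) + i \<le> k" and "card (A - C) \<le> m * (card V + 2 * i - 2 * k)"
  shows "(A, C) \<in> parcs (gen_johnson V k i) ^^ (2 * m)"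
  using assms(5-8)
proof (induction m arbitrary: C)
  case 0
  have fin: "finite A" "finite C"
    using A 0 \<open>finite V\<close> by (auto intro: finite_subset)
  then have "A \<subseteq> C" using 0 by auto
  then have "A = C" using fin A 0 card_subset_eq by metis
  then show ?case by simp
next
  case (Suc m)
  define d where "d = card (A - C)"
  \<comment> \<open>The largest useful exchange: \<open>C'\<close> and \<open>C\<close> may differ
    in at most \<Delta> points, and only \<open>d\<close> points remain to be exchanged.\<close>
  define e where "e = min d (card V + 2 * i - 2 * k)"
  have fin: "finite A" "finite C"
    using A Suc.prems \<open>finite V\<close> by (auto intro: finite_subset)
  have cCA: "card (C - A) = d"
    using card_le_sym_Diff[of A C] card_le_sym_Diff[of C A] fin A Suc.prems by (simp add: d_def)
  obtain R where R: "R \<subseteq> A - C" "card R = e" "finite R"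
    using obtain_subset_with_card_n[of e "A - C"] unfolding d_def e_def by auto
  obtain S where S: "S \<subseteq> C - A" "card S = e" "finite S"
    using obtain_subset_with_card_n[of e "C - A"] cCA unfolding e_def by auto
  define C' where "C' = (C - S) \<union> R"
  have C': "C' \<subseteq> V" using R A Suc.prems by (auto simp: C'_def)
  have "card C' = card (C - S) + card R"
    unfolding C'_def using R fin by (intro card_Un_disjoint) auto
  moreover have "card (C - S) + e = card C"
    using S fin card_mono[of C S] by (subst card_Diff_subset) force+
  ultimately have cC': "card C' = k" using R Suc.prems by simp
  have "A - C' = (A - C) - R" using S by (auto simp: C'_def)
  then have AC': "card (A - C') = d - e"
    using R by (simp add: card_Diff_subset d_def)
  have "C' - C = R" using R by (auto simp: C'_def)
  then have C'C: "card (C' - C) = e" using R by simp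
  have "(A, C') \<in> parcs (gen_johnson V k i) ^^ (2 * m)"
    using Suc.prems C' cC' AC' by (intro Suc.IH) (auto simp: e_def d_def)
  moreover have "2 * k + e \<le> card V + 2 * i" "e + i \<le> k"
    using assms(2) Suc.prems(3) by (auto simp: e_def d_def)
  then obtain B where "(C', B) \<in> parcs (gen_johnson V k i)" "(B, C) \<in> parcs (gen_johnson V k i)"
    using gen_johnson_common_neighbour[OF assms(1,2) C' cC' Suc.prems(1,2), of i] C'C by metis
  ultimately show ?case by auto
qed

lemma gen_johnson_arc_exists:
  assumes "finite V" and "2 * k \<le> card V" and "i \<le> k"
  obtains A C where "(A, C) \<in> parcs (gen_johnson V k i)"
proof -
  obtain A where A: "A \<subseteq> V" "card A = k" "finite A"
    using obtain_subset_with_card_n[of k V] assms by auto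
  obtain P where P: "P \<subseteq> A" "card P = i" "finite P"
    using obtain_subset_with_card_n[of i A] assms A by auto
  have "k - i \<le> card (V - A)"
    using assms A by (simp add: card_Diff_subset)
  then obtain Q where Q: "Q \<subseteq> V - A" "card Q = k - i" "finite Q"
    using obtain_subset_with_card_n[of "k - i" "V - A"] by auto
  have "card (P \<union> Q) = k" using P Q assms by (subst card_Un_disjoint) auto
  moreover have "A \<inter> (P \<union> Q) = P" using P Q by auto
  ultimately show thesis
    using that[of A "P \<union> Q"] A P Q by (auto simp: gen_johnson_arc_iff)
qed

section \<open>Odd closed walks and the formula\<close>

lemma gen_johnson_arc_card_Diff:
  assumes "finite V" and "(A, C) \<in> parcs (gen_johnson V k i)"
  shows "card (A - C) = k - i"
  using assms finite_subset[of A V]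
  by (auto simp: gen_johnson_arc_iff card_Diff_subset_Int)

lemma gen_johnson_odd_closed_walk_bound:
  assumes "finite V" and "(A, A) \<in> parcs (gen_johnson V k i) ^^ (2 * m + 1)"
  shows "k - i \<le> m * (card V + 2 * i - 2 * k)"
proof -
  obtain C where walk: "(A, C) \<in> parcs (gen_johnson V k i) ^^ (2 * m)"
    and "(C, A) \<in> parcs (gen_johnson V k i)"
    using assms(2) by auto
  then have "(A, C) \<in> parcs (gen_johnson V k i)"
    by (simp add: gen_johnson_arc_iff Int_commute)
  then show ?thesis
    using gen_johnson_arc_card_Diff[of V A C k i] gen_johnson_even_walk_card_Diff_le[OF assms(1) _ walk]
      assms(1) by (simp add: gen_johnson_arc_iff)
qed

text \<open>Any edge serves: its ends differ in \<open>k - i\<close> points, so an even walk joins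
  them and the edge closes it.\<close>

lemma gen_johnson_odd_closed_walk_exists:
  assumes "finite V" and "2 * k \<le> card V" and "i \<le> k"
    and "k - i \<le> m * (card V + 2 * i - 2 * k)"
  obtains A where "(A, A) \<in> parcs (gen_johnson V k i) ^^ (2 * m + 1)"
proof -
  obtain A C where AC: "(A, C) \<in> parcs (gen_johnson V k i)"
    using gen_johnson_arc_exists assms by blast
  then have "(C, A) \<in> parcs (gen_johnson V k i)"
    by (simp add: gen_johnson_arc_iff Int_commute)
  moreover have "(A, C) \<in> parcs (gen_johnson V k i) ^^ (2 * m)"
    using AC gen_johnson_arc_card_Diff[OF assms(1) AC] assms
    by (intro gen_johnson_even_walk_exists) (auto simp: gen_johnson_arc_iff)
  ultimately show thesis using that[of A] by auto
qed

theorem theorem5p5: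
  fixes V :: "'a set" and v k i :: nat and \<Delta> :: int
  assumes "finite V" and "card V = v"
    and "v > k" and "k > i"
    and "v \<ge> 2 * k" and "(v, k, i) \<noteq> (2 * k, k, 0)"
    and "\<Delta> = int v - 2 * int k + 2 * int i"
  shows "odd_girth (gen_johnson V k i) =
           enat (nat (2 * \<lceil>(real k - real i) / real_of_int \<Delta>\<rceil> + 1))"
proof -
  define D where "D = card V + 2 * i - 2 * k"
  define m where "m = nat \<lceil>(real k - real i) / real_of_int \<Delta>\<rceil>"
  \<comment> \<open>With \<open>v \<ge> 2 * k\<close> the natural subtraction is exact, and the
    excluded triple is precisely the case \<Delta> = 0.\<close>
  have D: "\<Delta> = int D" "D > 0"
    using assms by (auto simp: D_def)
  \<comment> \<open>Hence \<open>m\<close> is the least \<open>l\<close> with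
    \<open>k - i \<le> l * D\<close>: taking \<open>l = m\<close> yields a closed walk, and
    minimality yields the lower bound.\<close>
  have m_le_iff: "m \<le> l \<longleftrightarrow> k - i \<le> l * D" for l
  proof -
    have "m \<le> l \<longleftrightarrow> (real k - real i) / real D \<le> real l"
      unfolding m_def using D(1) by (simp add: nat_le_iff ceiling_le_iff)
    also have "\<dots> \<longleftrightarrow> real (k - i) \<le> real (l * D)"
      using D(2) \<open>k > i\<close> by (simp add: pos_divide_le_eq of_nat_diff)
    finally show ?thesis by (simp only: of_nat_le_iff)
  qed
  interpret pair_graph "gen_johnson V k i"
    using pair_graph_gen_johnson \<open>finite V\<close> \<open>k > i\<close> .
  obtain A where "(A, A) \<in> parcs (gen_johnson V k i) ^^ (2 * m + 1)"
    using gen_johnson_odd_closed_walk_exists[of V k i m] assms m_le_iff[of m] D_def by auto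
  moreover have "2 * m + 1 \<le> l"
    if "(B, B) \<in> parcs (gen_johnson V k i) ^^ l" "odd l" for B l
  proof -
    obtain l' where l': "l = 2 * l' + 1" using \<open>odd l\<close> oddE by blast
    then have "m \<le> l'"
      using gen_johnson_odd_closed_walk_bound[OF \<open>finite V\<close>] that(1) m_le_iff D_def by blast
    then show ?thesis using l' by simp
  qed
  ultimately have "odd_girth (gen_johnson V k i) = enat (2 * m + 1)"
    by (intro odd_girth_eqI[OF pair_wf_digraph_axioms]) auto
  \<comment> \<open>Nonnegativity ensures that \<open>nat\<close> in the definition of
    \<open>m\<close> does not change the ceiling.\<close>
  moreover have "0 \<le> (real k - real i) / real_of_int \<Delta>"
    using D \<open>k > i\<close> by simp
  then have "\<lceil>(real k - real i) / real_of_int \<Delta>\<rceil> = int m"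
    unfolding m_def by (simp add: le_ceiling_iff)
  then have "nat (2 * \<lceil>(real k - real i) / real_of_int \<Delta>\<rceil> + 1) = 2 * m + 1"
    by simp
  ultimately show ?thesis by simp
qed

end
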